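(* Given a $\Pi^0_1$ equivalence relation $E$ on $\mathbb{N}$, we can effectively obtain a computable function $f:\mathbb{N}\times\mathbb{N}\to\mathbb{N}$ such that for all $x,y\in\mathbb{N}$: $$(x,y)\in E\iff \forall n\ f(x,n)=f(y,n).$$ Here "effectively" means that there is an algorithm which, given an index $e$ of a recursively enumerable set $W_e\subseteq\mathbb{N}^2$ whose complement $E=\mathbb{N}^2\setminus W_e$ is an equivalence relation, outputs an index of such a total computable $f$.
   Context: $W_e$ denotes the $e$th recursively enumerable set, regarded as a subset of $\mathbb{N}\times\mathbb{N}$ via a computable pairing. A $\Pi^0_1$ equivalence relation is an equivalence relation on $\mathbb{N}$ whose complement in $\mathbb{N}^2$ is recursively enumerable. *)

theory Defs
  imports "HOL-Library.Nat_Bijection"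
begin

text \<open>
  The model of computation: programs for unary partial recursive functions on the natural
  numbers, with the Cantor pairing \<^const>\<open>prod_encode\<close> and its projections as basic functions.
  Functions of several arguments are unary functions of a coded tuple. Since the pairing and
  its projections are primitive recursive, closing under composition, primitive recursion and
  unbounded search gives exactly the (Kleene) partial recursive functions.
\<close>

datatype code =
    ZeroF
  | SuccF
  | FstF
  | SndF
  | PairF code code
  | CompF code code
  | PrecF code code
  | MuF code

text \<open>
  The result \<^const>\<open>None\<close> means divergence. All constructs are strict; in particular, search
  stops at \<open>n\<close> only if the searched function converges, to a nonzero value, at every \<open>m < n\<close>.
\<close>

primrec eval :: "code \<Rightarrow> nat \<Rightarrow> nat option" where
  "eval ZeroF x = Some 0"
| "eval SuccF x = Some (Suc x)"
| "eval FstF x = Some (fst (prod_decode x))"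
| "eval SndF x = Some (snd (prod_decode x))"
| "eval (PairF c d) x =
     Option.bind (eval c x) (\<lambda>u. Option.bind (eval d x) (\<lambda>v. Some (prod_encode (u, v))))"
| "eval (CompF c d) x = Option.bind (eval d x) (eval c)"
| "eval (PrecF c d) x =
     (case prod_decode x of (a, n) \<Rightarrow>
        rec_nat (eval c a)
          (\<lambda>m r. Option.bind r (\<lambda>v. eval d (prod_encode (a, prod_encode (m, v))))) n)"
| "eval (MuF c) x =
     (let stops = (\<lambda>n. eval c (prod_encode (x, n)) = Some 0 \<and>
                       (\<forall>m<n. \<exists>v. eval c (prod_encode (x, m)) = Some (Suc v)))
      in if \<exists>n. stops n then Some (LEAST n. stops n) else None)"

text \<open>An explicit, and hence effective, numbering: every natural number is an index.\<close>

function code_of :: "nat \<Rightarrow> code" where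
  "code_of n =
     (if n = 0 then ZeroF
      else if n = 1 then SuccF
      else if n = 2 then FstF
      else if n = 3 then SndF
      else let m = (n - 4) div 4; r = (n - 4) mod 4;
               c = code_of (fst (prod_decode m)); d = code_of (snd (prod_decode m))
           in if r = 0 then PairF c d
              else if r = 1 then CompF c d
              else if r = 2 then PrecF c d
              else MuF (code_of m))"
  by pat_completeness auto

lemma fst_prod_decode_le: "fst (prod_decode m) \<le> m"
  by (metis le_prod_encode_1 prod.collapse prod_decode_inverse)

lemma snd_prod_decode_le: "snd (prod_decode m) \<le> m"
  by (metis le_prod_encode_2 prod.collapse prod_decode_inverse)

lemma index_part_less: "n \<noteq> 0 \<Longrightarrow> (n - 4) div 4 < (n::nat)"
  by (rule le_less_trans[OF div_le_dividend]) simp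

termination code_of
proof (relation "measure id", goal_cases)
  case 1
  show ?case by simp
next
  case (2 n m r)
  then have "m < n" using index_part_less by metis
  with fst_prod_decode_le[of m] show ?case by simp
next
  case (3 n m r c)
  then have "m < n" using index_part_less by metis
  with snd_prod_decode_le[of m] show ?case by simp
next
  case (4 n m r c d)
  then have "m < n" using index_part_less by metis
  then show ?case by simp
qed

declare code_of.simps [simp del]

lemma surj_code_of: "surj code_of"
proof -
  have [simp]: "Suc (4 * k) div 4 = k" "Suc (Suc (4 * k)) div 4 = k"
    "Suc (Suc (Suc (4 * k))) div 4 = k"
    "Suc (4 * k) mod 4 = 1" "Suc (Suc (4 * k)) mod 4 = 2"
    "Suc (Suc (Suc (4 * k))) mod 4 = 3" for k :: nat by presburger+
  have "\<exists>n. code_of n = c" for c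
  proof (induction c)
    case ZeroF
    show ?case by (rule exI[of _ 0]) (simp add: code_of.simps)
  next
    case SuccF
    show ?case by (rule exI[of _ 1]) (simp add: code_of.simps)
  next
    case FstF
    show ?case by (rule exI[of _ 2]) (simp add: code_of.simps)
  next
    case SndF
    show ?case by (rule exI[of _ 3]) (simp add: code_of.simps)
  next
    case (PairF c d)
    then obtain i j where "code_of i = c" "code_of j = d" by blast
    then show ?case
      by (intro exI[of _ "4 * prod_encode (i, j) + 4"]) (subst code_of.simps, simp)
  next
    case (CompF c d)
    then obtain i j where "code_of i = c" "code_of j = d" by blast
    then show ?case
      by (intro exI[of _ "4 * prod_encode (i, j) + 5"]) (subst code_of.simps, simp add: Let_def)
  next
    case (PrecF c d)
    then obtain i j where "code_of i = c" "code_of j = d" by blast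
    then show ?case
      by (intro exI[of _ "4 * prod_encode (i, j) + 6"]) (subst code_of.simps, simp add: Let_def)
  next
    case (MuF c)
    then obtain i where "code_of i = c" by blast
    then show ?case
      by (intro exI[of _ "4 * i + 7"]) (subst code_of.simps, simp add: Let_def)
  qed
  then show ?thesis by (metis surjI)
qed

definition phi :: "nat \<Rightarrow> nat \<Rightarrow> nat option" where
  "phi e = eval (code_of e)"

definition W :: "nat \<Rightarrow> nat set" where
  "W e = dom (phi e)"

definition W2 :: "nat \<Rightarrow> (nat \<times> nat) set" where
  "W2 e = {(x, y). prod_encode (x, y) \<in> W e}"

definition total_index :: "nat \<Rightarrow> (nat \<times> nat \<Rightarrow> nat) \<Rightarrow> bool" where
  "total_index i f \<longleftrightarrow> (\<forall>x n. phi i (prod_encode (x, n)) = Some (f (x, n)))"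

end

theory Submission imports Defs begin

text \<open>
  Let \<open>Q\<^sub>t\<close> be the decidable relation ``not enumerated into \<open>W2 e\<close> by stage \<open>t\<close>''. Since \<open>E\<close> is an
  equivalence relation, for every \<open>m\<close> some stage \<open>t \<ge> m\<close> makes \<open>Q\<^sub>t\<close> an equivalence relation on
  \<open>{0..m}\<close>; let \<open>T m\<close> be the least one, which is monotone in \<open>m\<close>. For fixed \<open>n\<close> send \<open>x\<close> to its
  least \<open>Q\<^sub>t\<close>-equivalent with \<open>t = T (max x n)\<close>, and let \<open>f (x, n)\<close> be the fixed point reached by
  iterating this map. Numbers of different colours are never \<open>E\<close>-equivalent, and on \<open>{0..n}\<close> the
  colours separate all the classes of \<open>Q\<close> at stage \<open>T n\<close>.

  Uniformity in \<open>e\<close> requires no universal program: a step-bounded version of a program is another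
  program, obtained by structural recursion, and its index is computed by course-of-values recursion.
\<close>

abbreviation pair :: "nat \<Rightarrow> nat \<Rightarrow> nat" where
  "pair x y \<equiv> prod_encode (x, y)"

abbreviation pr1 :: "nat \<Rightarrow> nat" where
  "pr1 z \<equiv> fst (prod_decode z)"

abbreviation pr2 :: "nat \<Rightarrow> nat" where
  "pr2 z \<equiv> snd (prod_decode z)"

lemma pair_pr [simp]: "pair (pr1 z) (pr2 z) = z"
  by simp

section \<open>Computable functions and index arithmetic\<close>

definition computable :: "(nat \<Rightarrow> nat) \<Rightarrow> bool" where
  "computable g \<longleftrightarrow> (\<exists>c. \<forall>x. eval c x = Some (g x))"

lemma computableI: "(\<And>x. eval c x = Some (g x)) \<Longrightarrow> computable g"
  unfolding computable_def by blast

lemma computable_id: "computable (\<lambda>x. x)"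
  by (rule computableI[of "PairF FstF SndF"]) simp

lemma computable_Suc: "computable G \<Longrightarrow> computable (\<lambda>x. Suc (G x))"
  unfolding computable_def by (elim exE, rule_tac x = "CompF SuccF c" in exI) simp

lemma computable_pr1: "computable G \<Longrightarrow> computable (\<lambda>x. pr1 (G x))"
  unfolding computable_def by (elim exE, rule_tac x = "CompF FstF c" in exI) simp

lemma computable_pr2: "computable G \<Longrightarrow> computable (\<lambda>x. pr2 (G x))"
  unfolding computable_def by (elim exE, rule_tac x = "CompF SndF c" in exI) simp

lemma computable_const: "computable (\<lambda>x. k)"
proof (induction k)
  case 0
  show ?case by (rule computableI[of ZeroF]) simp
qed (rule computable_Suc)

lemma computable_comp:
  assumes "computable F" "computable G"
  shows "computable (\<lambda>x. F (G x))"
proof -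
  obtain c d where "\<And>x. eval c x = Some (F x)" "\<And>x. eval d x = Some (G x)"
    using assms unfolding computable_def by blast
  then show ?thesis by (intro computableI[of "CompF c d"]) simp
qed

lemma computable_pair:
  assumes "computable F" "computable G"
  shows "computable (\<lambda>x. pair (F x) (G x))"
proof -
  obtain c d where "\<And>x. eval c x = Some (F x)" "\<And>x. eval d x = Some (G x)"
    using assms unfolding computable_def by blast
  then show ?thesis by (intro computableI[of "PairF c d"]) simp
qed

lemma rec_nat_bind_Some:
  "rec_nat (Some b) (\<lambda>m r. Option.bind r (\<lambda>v. Some (d m v))) n = Some (rec_nat b d n)"
  by (induction n) auto

lemma computable_double: "computable (\<lambda>x. 2 * x)"
proof (rule computableI)
  fix x :: nat
  have "rec_nat 0 (\<lambda>m v. Suc (Suc v)) x = 2 * x" by (induction x) auto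
  \<comment> \<open>\<open>PairF ZeroF (PairF FstF SndF)\<close> builds a dummy parameter 0 together
    with the iteration count \<open>x\<close>; \<open>CompF SndF SndF\<close> extracts the previous
    value.\<close>
  then show "eval (CompF (PrecF ZeroF (CompF SuccF (CompF SuccF (CompF SndF SndF))))
      (PairF ZeroF (PairF FstF SndF))) x = Some (2 * x)"
    by (simp add: rec_nat_bind_Some)
qed

lemma computable_four_times_add: "computable G \<Longrightarrow> computable (\<lambda>x. 4 * G x + k)"
proof (induction k)
  case 0
  then show ?case
    using computable_comp[OF computable_double computable_comp[OF computable_double]] by fastforce
next
  case (Suc k)
  then show ?case using computable_Suc by fastforce
qed

text \<open>An index of a compound program is an affine function of the (paired) indices of its
  parts, so that assembling programs is a computable operation on indices.\<close>

lemma code_of_constructors: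
  "code_of (4 * pair i j + 4) = PairF (code_of i) (code_of j)"
  "code_of (4 * pair i j + 5) = CompF (code_of i) (code_of j)"
  "code_of (4 * pair i j + 6) = PrecF (code_of i) (code_of j)"
  "code_of (4 * i + 7) = MuF (code_of i)"
proof -
  have *: "Suc (4 * k) div 4 = k" "Suc (Suc (4 * k)) div 4 = k"
    "Suc (Suc (Suc (4 * k))) div 4 = k"
    "Suc (4 * k) mod 4 = 1" "Suc (Suc (4 * k)) mod 4 = 2"
    "Suc (Suc (Suc (4 * k))) mod 4 = 3" for k :: nat by presburger+
  show "code_of (4 * pair i j + 4) = PairF (code_of i) (code_of j)"
    by (subst code_of.simps) (simp add: * Let_def)
  show "code_of (4 * pair i j + 5) = CompF (code_of i) (code_of j)"
    by (subst code_of.simps) (simp add: * Let_def)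
  show "code_of (4 * pair i j + 6) = PrecF (code_of i) (code_of j)"
    by (subst code_of.simps) (simp add: * Let_def)
  show "code_of (4 * i + 7) = MuF (code_of i)"
    by (subst code_of.simps) (simp add: * Let_def)
qed

section \<open>Uniformly computable families\<close>

text \<open>The parameter \<open>e\<close> is compiled into the program by the index map
  \<open>g\<close>; it is no run-time input. Totality is demanded on \<open>S\<close> only, since
  later searches need not terminate for other \<open>e\<close>.\<close>

definition ucomp :: "nat set \<Rightarrow> (nat \<Rightarrow> nat \<Rightarrow> nat) \<Rightarrow> bool" where
  "ucomp S G \<longleftrightarrow> (\<exists>g. computable g \<and> (\<forall>e\<in>S. \<forall>x. phi (g e) x = Some (G e x)))"

abbreviation udec :: "nat set \<Rightarrow> (nat \<Rightarrow> nat \<Rightarrow> bool) \<Rightarrow> bool" where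
  "udec S P \<equiv> ucomp S (\<lambda>e x. of_bool (P e x))"

lemma ucompI:
  "computable g \<Longrightarrow> (\<And>e x. e \<in> S \<Longrightarrow> phi (g e) x = Some (G e x)) \<Longrightarrow> ucomp S G"
  unfolding ucomp_def by blast

lemma ucompE:
  assumes "ucomp S G"
  obtains g where "computable g" "\<And>e x. e \<in> S \<Longrightarrow> eval (code_of (g e)) x = Some (G e x)"
  using assms unfolding ucomp_def phi_def by blast

lemma ucomp_cong:
  assumes "ucomp S F" "\<And>e x. e \<in> S \<Longrightarrow> F e x = G e x"
  shows "ucomp S G"
  using assms unfolding ucomp_def by auto

lemma ucomp_computable: "computable F \<Longrightarrow> ucomp S (\<lambda>e. F)"
proof -
  assume "computable F"
  then obtain c where c: "\<And>x. eval c x = Some (F x)" unfolding computable_def by blast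
  obtain i where "code_of i = c" using surj_code_of by (metis surjD)
  with c show ?thesis
    by (intro ucompI[of "\<lambda>e. i"] computable_const) (simp add: phi_def)
qed

lemma computable_ucomp: "ucomp UNIV (\<lambda>e. F) \<Longrightarrow> computable F"
  unfolding ucomp_def computable_def phi_def by auto

lemma ucomp_phi:
  assumes "computable g" "\<And>e x. e \<in> S \<Longrightarrow> phi (g e) x \<noteq> None"
  shows "ucomp S (\<lambda>e x. the (phi (g e) x))"
  using assms by (intro ucompI[of g]) auto

lemma ucomp_comp:
  assumes "ucomp S F" "ucomp S G"
  shows "ucomp S (\<lambda>e x. F e (G e x))"
proof -
  obtain f where f: "computable f" "\<And>e x. e \<in> S \<Longrightarrow> eval (code_of (f e)) x = Some (F e x)"
    using assms(1) by (rule ucompE) blast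
  obtain g where g: "computable g" "\<And>e x. e \<in> S \<Longrightarrow> eval (code_of (g e)) x = Some (G e x)"
    using assms(2) by (rule ucompE) blast
  have "computable (\<lambda>e. 4 * pair (f e) (g e) + 5)"
    by (intro computable_four_times_add computable_pair f g)
  then show ?thesis
    by (rule ucompI) (simp only: phi_def code_of_constructors, simp add: f g)
qed

lemma ucomp_pair:
  assumes "ucomp S F" "ucomp S G"
  shows "ucomp S (\<lambda>e x. pair (F e x) (G e x))"
proof -
  obtain f where f: "computable f" "\<And>e x. e \<in> S \<Longrightarrow> eval (code_of (f e)) x = Some (F e x)"
    using assms(1) by (rule ucompE) blast
  obtain g where g: "computable g" "\<And>e x. e \<in> S \<Longrightarrow> eval (code_of (g e)) x = Some (G e x)"
    using assms(2) by (rule ucompE) blast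
  have "computable (\<lambda>e. 4 * pair (f e) (g e) + 4)"
    by (intro computable_four_times_add computable_pair f g)
  then show ?thesis
    by (rule ucompI) (simp only: phi_def code_of_constructors, simp add: f g)
qed

lemmas ucomp_id = ucomp_computable[OF computable_id]
lemmas ucomp_const = ucomp_computable[OF computable_const]
lemmas ucomp_Suc = ucomp_comp[OF ucomp_computable[OF computable_Suc[OF computable_id]]]
lemmas ucomp_pr1 = ucomp_comp[OF ucomp_computable[OF computable_pr1[OF computable_id]]]
lemmas ucomp_pr2 = ucomp_comp[OF ucomp_computable[OF computable_pr2[OF computable_id]]]

lemma ucomp_rec:
  assumes "ucomp S B" "ucomp S (\<lambda>e z. D e (pr1 z) (pr1 (pr2 z)) (pr2 (pr2 z)))" "ucomp S N"
  shows "ucomp S (\<lambda>e x. rec_nat (B e x) (\<lambda>m v. D e x m v) (N e x))"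
proof -
  obtain b where b: "computable b" "\<And>e x. e \<in> S \<Longrightarrow> eval (code_of (b e)) x = Some (B e x)"
    using assms(1) by (rule ucompE) blast
  obtain d where d: "computable d" "\<And>e z. e \<in> S \<Longrightarrow>
      eval (code_of (d e)) z = Some (D e (pr1 z) (pr1 (pr2 z)) (pr2 (pr2 z)))"
    using assms(2) by (rule ucompE) blast
  have "computable (\<lambda>e. 4 * pair (b e) (d e) + 6)"
    by (intro computable_four_times_add computable_pair b d)
  then have "ucomp S (\<lambda>e z. rec_nat (B e (pr1 z)) (\<lambda>m v. D e (pr1 z) m v) (pr2 z))"
    by (rule ucompI)
      (simp only: phi_def code_of_constructors, simp add: b d rec_nat_bind_Some split: prod.split)
  from ucomp_comp[OF this ucomp_pair[OF ucomp_id assms(3)]] show ?thesis by simp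
qed

section \<open>Case distinction, connectives, arithmetic and bounded quantifiers\<close>

lemma ucomp_if:
  assumes "udec S P" "ucomp S F" "ucomp S G"
  shows "ucomp S (\<lambda>e x. if P e x then F e x else G e x)"
proof -
  \<comment> \<open>Branching is a recursion of length 0 or 1. Both branches may get evaluated,
    which is harmless since they are total on \<open>S\<close>.\<close>
  have "ucomp S (\<lambda>e x. rec_nat (G e x) (\<lambda>m v. F e x) (of_bool (P e x)))"
    by (intro ucomp_rec ucomp_comp[OF assms(2)] ucomp_pr1 ucomp_id assms)
  then show ?thesis by (rule ucomp_cong) auto
qed

lemma udec_not: "udec S P \<Longrightarrow> udec S (\<lambda>e x. \<not> P e x)"
  by (rule ucomp_cong[OF ucomp_if[OF _ ucomp_const[of _ 0] ucomp_const[of _ 1]]]) auto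

lemma udec_conj: "udec S P \<Longrightarrow> udec S Q \<Longrightarrow> udec S (\<lambda>e x. P e x \<and> Q e x)"
  by (rule ucomp_cong[OF ucomp_if[OF _ _ ucomp_const[of _ 0],
        of S P "\<lambda>e x. of_bool (Q e x)"]]) auto

lemma udec_disj: "udec S P \<Longrightarrow> udec S Q \<Longrightarrow> udec S (\<lambda>e x. P e x \<or> Q e x)"
  by (rule ucomp_cong[OF ucomp_if[OF _ ucomp_const[of _ 1],
        of S P "\<lambda>e x. of_bool (Q e x)"]]) auto

lemma udec_imp: "udec S P \<Longrightarrow> udec S Q \<Longrightarrow> udec S (\<lambda>e x. P e x \<longrightarrow> Q e x)"
  by (rule ucomp_cong[OF ucomp_if[OF _ _ ucomp_const[of _ 1],
        of S P "\<lambda>e x. of_bool (Q e x)"]]) auto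

lemma ucomp_pred: "ucomp S F \<Longrightarrow> ucomp S (\<lambda>e x. F e x - 1)"
proof -
  assume F: "ucomp S F"
  have "ucomp S (\<lambda>e x. rec_nat 0 (\<lambda>m v. m) (F e x))"
    by (intro ucomp_rec ucomp_const ucomp_pr1 ucomp_pr2 ucomp_id F)
  moreover have "rec_nat 0 (\<lambda>m v. m) n = n - 1" for n :: nat by (cases n) auto
  ultimately show ?thesis by simp
qed

lemma ucomp_add:
  assumes "ucomp S F" "ucomp S G"
  shows "ucomp S (\<lambda>e x. F e x + G e x)"
proof -
  have "ucomp S (\<lambda>e x. rec_nat (F e x) (\<lambda>m v. Suc v) (G e x))"
    by (intro ucomp_rec ucomp_Suc ucomp_pr2 ucomp_id assms)
  moreover have "rec_nat k (\<lambda>m v. Suc v) n = k + n" for k n by (induction n) auto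
  ultimately show ?thesis by simp
qed

lemma ucomp_diff:
  assumes "ucomp S F" "ucomp S G"
  shows "ucomp S (\<lambda>e x. F e x - G e x)"
proof -
  have "ucomp S (\<lambda>e x. rec_nat (F e x) (\<lambda>m v. v - 1) (G e x))"
    by (intro ucomp_rec ucomp_pred ucomp_pr2 ucomp_id assms)
  moreover have "rec_nat k (\<lambda>m v. v - 1) n = k - n" for k n :: nat by (induction n) auto
  ultimately show ?thesis by simp
qed

lemma udec_less:
  assumes "ucomp S F" "ucomp S G"
  shows "udec S (\<lambda>e x. F e x < G e x)"
proof -
  have "ucomp S (\<lambda>e x. rec_nat 0 (\<lambda>m v. 1) (G e x - F e x))"
    by (intro ucomp_rec ucomp_diff ucomp_const assms)
  moreover have "rec_nat 0 (\<lambda>m v. 1) (n - k) = (of_bool (k < n) :: nat)" for k n :: nat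
    by (cases "n - k") auto
  ultimately show ?thesis by simp
qed

lemma udec_le: "ucomp S F \<Longrightarrow> ucomp S G \<Longrightarrow> udec S (\<lambda>e x. F e x \<le> G e x)"
  using udec_not[OF udec_less, of S G F] by (simp add: not_less)

lemma udec_eq:
  assumes "ucomp S F" "ucomp S G"
  shows "udec S (\<lambda>e x. F e x = G e x)"
  by (rule ucomp_cong[OF udec_conj[OF udec_le[OF assms] udec_le[OF assms(2,1)]]]) auto

lemma udec_all_less:
  assumes "udec S (\<lambda>e z. P e (pr1 z) (pr2 z))" "ucomp S N"
  shows "udec S (\<lambda>e x. \<forall>i<N e x. P e x i)"
proof -
  have P: "udec S (\<lambda>e x. P e (F e x) (G e x))" if "ucomp S F" "ucomp S G" for F G
    using ucomp_comp[OF assms(1) ucomp_pair[OF that]] by simp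
  have "ucomp S (\<lambda>e x. rec_nat 1 (\<lambda>m v. if P e x m then v else 0) (N e x))"
    by (intro ucomp_rec ucomp_if P ucomp_const ucomp_pr1 ucomp_pr2 ucomp_id assms)
  moreover have "rec_nat 1 (\<lambda>m v. if Q m then v else 0) n = (of_bool (\<forall>i<n. Q i) :: nat)"
    for Q and n :: nat by (induction n) (auto simp: less_Suc_eq)
  ultimately show ?thesis by simp
qed

lemma udec_all_le:
  assumes "udec S (\<lambda>e z. P e (pr1 z) (pr2 z))" "ucomp S N"
  shows "udec S (\<lambda>e x. \<forall>i\<le>N e x. P e x i)"
  using udec_all_less[OF assms(1) ucomp_Suc[OF assms(2)]] by (simp add: less_Suc_eq_le)

section \<open>Unbounded search\<close>

lemma eval_MuF_total:
  assumes "\<And>n. eval c (pair x n) = Some (of_bool (\<not> P n))" "\<exists>n. P n"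
  shows "eval (MuF c) x = Some (LEAST n. P n)"
proof -
  define stops where "stops = (\<lambda>n. eval c (pair x n) = Some 0 \<and>
      (\<forall>m<n. \<exists>v. eval c (pair x m) = Some (Suc v)))"
  have *: "stops n \<longleftrightarrow> P n \<and> (\<forall>m<n. \<not> P m)" for n
    unfolding stops_def assms(1) by (auto simp: of_bool_def)
  have st: "stops (LEAST n. P n)"
    unfolding * using assms(2) by (auto intro: LeastI_ex dest: not_less_Least)
  moreover have "(LEAST n. stops n) = (LEAST n. P n)"
    by (rule Least_equality, rule st) (simp add: * Least_le)
  ultimately show ?thesis by (auto simp: Let_def stops_def)
qed

lemma ucomp_Least:
  assumes "udec S (\<lambda>e z. P e (pr1 z) (pr2 z))" "\<And>e x. e \<in> S \<Longrightarrow> \<exists>n. P e x n"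
  shows "ucomp S (\<lambda>e x. LEAST n. P e x n)"
proof -
  \<comment> \<open>Search stops at the value 0, so the searched program has to decide the negation
    of \<open>P\<close>.\<close>
  obtain g where g: "computable g" "\<And>e z. e \<in> S \<Longrightarrow>
      eval (code_of (g e)) z = Some (of_bool (\<not> P e (pr1 z) (pr2 z)))"
    using udec_not[OF assms(1)] by (rule ucompE) blast
  have "computable (\<lambda>e. 4 * g e + 7)"
    by (intro computable_four_times_add g)
  then show ?thesis
  proof (rule ucompI)
    fix e x assume "e \<in> S"
    then show "phi (4 * g e + 7) x = Some (LEAST n. P e x n)"
      unfolding phi_def code_of_constructors
      by (intro eval_MuF_total) (auto simp: g assms(2))
  qed
qed

lemmas ucomp_intros = ucomp_const ucomp_id ucomp_Suc ucomp_pr1 ucomp_pr2 ucomp_pair ucomp_rec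
  ucomp_if ucomp_add ucomp_diff udec_not udec_conj udec_disj udec_imp udec_less udec_le udec_eq
  udec_all_less udec_all_le

text \<open>Decoding an index takes division by 4. The quotient is found by search as the least
  \<open>q\<close> with \<open>n < 4 * (q + 1)\<close>, the multiple being spelt out as a
  sum.\<close>

lemma ucomp_div4:
  assumes "ucomp S F"
  shows "ucomp S (\<lambda>e x. F e x div 4)"
proof -
  have F: "ucomp S (\<lambda>e x. F e (G e x))" if "ucomp S G" for G
    using assms that by (rule ucomp_comp)
  have "ucomp S (\<lambda>e x. LEAST q. F e x < q + q + q + q + 4)"
  proof (intro ucomp_Least ucomp_intros F)
    fix e x show "\<exists>q. F e x < q + q + q + q + 4"
      by (rule exI[of _ "F e x"]) simp
  qed
  moreover have "(LEAST q. n < q + q + q + q + 4) = n div 4" for n :: nat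
    by (rule Least_equality) presburger+
  ultimately show ?thesis by simp
qed

lemma ucomp_mod4:
  assumes "ucomp S F"
  shows "ucomp S (\<lambda>e x. F e x mod 4)"
proof -
  have "ucomp S (\<lambda>e x. F e x - (F e x div 4 + F e x div 4 + F e x div 4 + F e x div 4))"
    by (intro ucomp_intros ucomp_div4 assms)
  moreover have "n - (n div 4 + n div 4 + n div 4 + n div 4) = n mod 4" for n :: nat
    by presburger
  ultimately show ?thesis by simp
qed

section \<open>Course-of-values recursion\<close>

text \<open>Values are stacked by nested pairing, the most recent outermost.\<close>

primrec history :: "(nat \<Rightarrow> nat) \<Rightarrow> nat \<Rightarrow> nat" where
  "history h 0 = 0"
| "history h (Suc n) = pair (h n) (history h n)"

text \<open>On top of value \<open>j\<close> lie \<open>n - Suc j\<close> more recent ones, which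
  the second projections remove.\<close>

definition lookup :: "nat \<Rightarrow> nat \<Rightarrow> nat \<Rightarrow> nat" where
  "lookup n v j = pr1 (rec_nat v (\<lambda>m w. pr2 w) (n - Suc j))"

lemma lookup_history:
  assumes "j < n"
  shows "lookup n (history h n) j = h j"
proof -
  have "rec_nat (history h n) (\<lambda>m w. pr2 w) k = history h (n - k)" if "k \<le> n" for k
    using that
  proof (induction k)
    case (Suc k)
    then have "n - k = Suc (n - Suc k)" by simp
    with Suc show ?case by simp
  qed simp
  moreover have "n - (n - Suc j) = Suc j" using assms by simp
  ultimately show ?thesis by (simp add: lookup_def)
qed

lemma ucomp_lookup:
  "ucomp S N \<Longrightarrow> ucomp S V \<Longrightarrow> ucomp S J \<Longrightarrow> ucomp S (\<lambda>e x. lookup (N e x) (V e x) (J e x))"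
  unfolding lookup_def by (intro ucomp_intros)

text \<open>Primitive recursion hands on a single number; here it is the coded history
  \<open>t\<close>, from which \<open>h\<close> arises by one more application of
  \<open>G\<close>.\<close>

lemma course_of_values:
  assumes "computable (\<lambda>z. G (pr1 z) (pr2 z))"
  shows "\<exists>h. computable h \<and> (\<forall>n. h n = G n (history h n))"
proof -
  have G: "ucomp S (\<lambda>e x. G (A e x) (B e x))" if "ucomp S A" "ucomp S B" for S A B
    using ucomp_comp[OF ucomp_computable[OF assms] ucomp_pair[OF that]] by simp
  define t where "t = rec_nat 0 (\<lambda>m v. pair (G m v) v)"
  define h where "h n = G n (t n)" for n
  have "computable h"
    unfolding h_def t_def by (intro computable_ucomp ucomp_intros G)
  moreover have "history h n = t n" for n
    by (induction n) (simp_all add: h_def t_def)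
  ultimately show ?thesis by (auto simp: h_def)
qed

section \<open>Step-bounded evaluation\<close>

text \<open>Only unbounded search needs a bound: everything else terminates relative to its parts.\<close>

primrec eval_upto :: "code \<Rightarrow> nat \<Rightarrow> nat \<Rightarrow> nat option" where
  "eval_upto ZeroF s x = Some 0"
| "eval_upto SuccF s x = Some (Suc x)"
| "eval_upto FstF s x = Some (pr1 x)"
| "eval_upto SndF s x = Some (pr2 x)"
| "eval_upto (PairF c d) s x =
     Option.bind (eval_upto c s x) (\<lambda>u. Option.bind (eval_upto d s x) (\<lambda>v. Some (pair u v)))"
| "eval_upto (CompF c d) s x = Option.bind (eval_upto d s x) (eval_upto c s)"
| "eval_upto (PrecF c d) s x =
     rec_nat (eval_upto c s (pr1 x))
       (\<lambda>m r. Option.bind r (\<lambda>v. eval_upto d s (pair (pr1 x) (pair m v)))) (pr2 x)"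
| "eval_upto (MuF c) s x =
     (let stops = (\<lambda>n. eval_upto c s (pair x n) = Some 0 \<and>
                       (\<forall>m<n. \<exists>v. eval_upto c s (pair x m) = Some (Suc v)))
      in if \<exists>n<s. stops n then Some (LEAST n. stops n) else None)"

text \<open>Abstracting from the searched function lets the same facts serve \<open>eval\<close> and
  \<open>eval_upto\<close>.\<close>

definition search_stops :: "(nat \<Rightarrow> nat option) \<Rightarrow> nat \<Rightarrow> bool" where
  "search_stops f n \<longleftrightarrow> f n = Some 0 \<and> (\<forall>m<n. \<exists>v. f m = Some (Suc v))"

text \<open>Of two stopping points, the larger would require a nonzero value at the smaller, where
  the value is 0.\<close>

lemma Least_search_stops:
  assumes "search_stops f n"
  shows "(LEAST n. search_stops f n) = n"
proof (rule Least_equality)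
  show "search_stops f n" by (rule assms)
next
  fix k assume "search_stops f k"
  with assms show "n \<le> k" unfolding search_stops_def
    by (metis not_le nat.distinct(1) option.inject)
qed

lemma eval_MuF_eq_Some: "eval (MuF c) x = Some n \<longleftrightarrow> search_stops (\<lambda>n. eval c (pair x n)) n"
proof -
  have "eval (MuF c) x = (if \<exists>n. search_stops (\<lambda>n. eval c (pair x n)) n
      then Some (LEAST n. search_stops (\<lambda>n. eval c (pair x n)) n) else None)"
    by (simp add: search_stops_def Let_def)
  then show ?thesis using Least_search_stops by auto
qed

lemma eval_upto_MuF: "eval_upto (MuF c) s x =
   (if \<exists>n<s. search_stops (\<lambda>n. eval_upto c s (pair x n)) n
    then Some (LEAST n. search_stops (\<lambda>n. eval_upto c s (pair x n)) n) else None)"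
  unfolding search_stops_def eval_upto.simps Let_def ..

lemma eval_upto_MuF_eq_Some:
  "eval_upto (MuF c) s x = Some n \<longleftrightarrow> n < s \<and> search_stops (\<lambda>n. eval_upto c s (pair x n)) n"
  unfolding eval_upto_MuF using Least_search_stops by (auto split: if_splits)

lemma search_stops_mono:
  assumes "search_stops f n" "\<And>m v. m \<le> n \<Longrightarrow> f m = Some v \<Longrightarrow> g m = Some v"
  shows "search_stops g n"
  using assms unfolding search_stops_def by (meson le_refl less_imp_le)

declare eval_upto.simps(8) [simp del]
declare eval.simps(8) [simp del]

lemma rec_nat_bind_mono:
  assumes "rec_nat b (\<lambda>m r. Option.bind r (d m)) n = Some v"
    and "\<And>v. b = Some v \<Longrightarrow> b' = Some v" "\<And>m u v. d m u = Some v \<Longrightarrow> d' m u = Some v"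
  shows "rec_nat b' (\<lambda>m r. Option.bind r (d' m)) n = Some v"
  using assms(1)
proof (induction n arbitrary: v)
  case (Suc n)
  then obtain u where "rec_nat b (\<lambda>m r. Option.bind r (d m)) n = Some u" "d n u = Some v"
    by (auto simp: bind_eq_Some_conv)
  with Suc.IH assms(3) show ?case by simp
qed (use assms(2) in simp)

section \<open>Bounded evaluation: monotonicity, soundness and completeness\<close>

lemma eval_upto_mono: "eval_upto c s x = Some v \<Longrightarrow> s \<le> t \<Longrightarrow> eval_upto c t x = Some v"
proof (induction c arbitrary: x v)
  case (PrecF c d)
  then show ?case by (auto elim!: rec_nat_bind_mono)
next
  case (MuF c)
  then show ?case by (auto simp: eval_upto_MuF_eq_Some elim!: search_stops_mono)
qed (fastforce simp: bind_eq_Some_conv)+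

lemma eval_upto_sound: "eval_upto c s x = Some v \<Longrightarrow> eval c x = Some v"
proof (induction c arbitrary: x v)
  case (PrecF c d)
  then show ?case by (auto split: prod.split elim!: rec_nat_bind_mono)
next
  case (MuF c)
  then show ?case
    by (auto simp: eval_upto_MuF_eq_Some eval_MuF_eq_Some elim!: search_stops_mono)
qed (fastforce simp: bind_eq_Some_conv)+

text \<open>A convergent computation has finitely many subcomputations; the maximum of their bounds
  works for all of them by \<open>eval_upto_mono\<close>.\<close>

lemma eval_upto_complete: "eval c x = Some v \<Longrightarrow> \<exists>s. eval_upto c s x = Some v"
proof (induction c arbitrary: x v)
  case (PairF c d)
  then obtain u w where uw: "eval c x = Some u" "eval d x = Some w" "v = pair u w"
    by (auto simp: bind_eq_Some_conv)
  from uw PairF.IH obtain s t where "eval_upto c s x = Some u" "eval_upto d t x = Some w" by blast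
  then have "eval_upto c (max s t) x = Some u" "eval_upto d (max s t) x = Some w"
    by (auto elim: eval_upto_mono)
  then show ?case using uw by (intro exI[of _ "max s t"]) simp
next
  case (CompF c d)
  then obtain u where u: "eval d x = Some u" "eval c u = Some v"
    by (auto simp: bind_eq_Some_conv)
  from u CompF.IH obtain s t where "eval_upto c s u = Some v" "eval_upto d t x = Some u" by blast
  then have "eval_upto c (max s t) u = Some v" "eval_upto d (max s t) x = Some u"
    by (auto elim: eval_upto_mono)
  then show ?case by (intro exI[of _ "max s t"]) simp
next
  case (PrecF c d)
  have "\<exists>s. eval_upto (PrecF c d) s (pair a n) = Some v"
    if "eval (PrecF c d) (pair a n) = Some v" for a n
    using that
  proof (induction n arbitrary: v)
    case 0
    then show ?case using PrecF.IH(1) by simp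
  next
    case (Suc n)
    then obtain u where u: "eval (PrecF c d) (pair a n) = Some u"
      "eval d (pair a (pair n u)) = Some v"
      by (auto simp: bind_eq_Some_conv)
    from u Suc.IH PrecF.IH obtain s t where "eval_upto (PrecF c d) s (pair a n) = Some u"
      "eval_upto d t (pair a (pair n u)) = Some v" by blast
    then have "eval_upto (PrecF c d) (max s t) (pair a n) = Some u"
      "eval_upto d (max s t) (pair a (pair n u)) = Some v"
      by (meson eval_upto_mono max.cobounded1 max.cobounded2)+
    then show ?case by (intro exI[of _ "max s t"]) simp
  qed
  with PrecF.prems show ?case by (metis pair_pr)
next
  case (MuF c)
  then have st: "search_stops (\<lambda>n. eval c (pair x n)) v" by (simp add: eval_MuF_eq_Some)
  have "\<exists>s. \<forall>w. eval c (pair x m) = Some w \<longrightarrow> eval_upto c s (pair x m) = Some w" for m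
    using MuF.IH by (cases "eval c (pair x m)") auto
  then obtain S where
    S: "\<And>m w. eval c (pair x m) = Some w \<Longrightarrow> eval_upto c (S m) (pair x m) = Some w"
    by metis
  \<comment> \<open>The search inspects the arguments up to \<open>v\<close>. Besides dominating
    their bounds, \<open>s\<close> must exceed \<open>v\<close>, because \<open>eval_upto\<close>
    admits only stopping points below the bound.\<close>
  define s where "s = Max (insert (Suc v) (S ` {..v}))"
  have "S m \<le> s" if "m \<le> v" for m
    unfolding s_def using that by (intro Max_ge) auto
  moreover have "v < s"
    unfolding s_def by (intro less_le_trans[OF lessI Max_ge]) auto
  ultimately have "v < s \<and> search_stops (\<lambda>n. eval_upto c s (pair x n)) v"
    using search_stops_mono[OF st] S eval_upto_mono by meson
  then show ?case unfolding eval_upto_MuF_eq_Some by blast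
qed auto

section \<open>Bounded evaluation as total functions on numbers\<close>

fun enc :: "nat option \<Rightarrow> nat" where
  "enc None = 0"
| "enc (Some v) = Suc v"

lemma enc_eq_0 [simp]: "enc r = 0 \<longleftrightarrow> r = None"
  by (cases r) auto

text \<open>Bounded evaluation becomes total once failure is coded by 0 and results are shifted by
  one. The argument codes the input and the bound.\<close>

definition stage :: "code \<Rightarrow> nat \<Rightarrow> nat" where
  "stage c z = enc (eval_upto c (pr2 z) (pr1 z))"

text \<open>This operator and the three after it transfer the compound clauses of
  \<open>eval_upto\<close> to coded results. Taking arbitrary functions as arguments, they can be
  turned into maps on indices.\<close>

definition stage_PairF :: "(nat \<Rightarrow> nat) \<Rightarrow> (nat \<Rightarrow> nat) \<Rightarrow> nat \<Rightarrow> nat" where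
  "stage_PairF A B z = (if A z = 0 \<or> B z = 0 then 0 else Suc (pair (A z - 1) (B z - 1)))"

definition stage_CompF :: "(nat \<Rightarrow> nat) \<Rightarrow> (nat \<Rightarrow> nat) \<Rightarrow> nat \<Rightarrow> nat" where
  "stage_CompF A B z = (if B z = 0 then 0 else A (pair (B z - 1) (pr2 z)))"

definition stage_PrecF :: "(nat \<Rightarrow> nat) \<Rightarrow> (nat \<Rightarrow> nat) \<Rightarrow> nat \<Rightarrow> nat" where
  "stage_PrecF A B z = rec_nat (A (pair (pr1 (pr1 z)) (pr2 z)))
     (\<lambda>m r. if r = 0 then 0 else B (pair (pair (pr1 (pr1 z)) (pair m (r - 1))) (pr2 z)))
     (pr2 (pr1 z))"

text \<open>The disjunct \<open>pr2 z \<le> n\<close> makes the search total without affecting its result.\<close>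

definition stage_MuF :: "(nat \<Rightarrow> nat) \<Rightarrow> nat \<Rightarrow> nat" where
  "stage_MuF A z =
     (let stops = (\<lambda>n. A (pair (pair (pr1 z) n) (pr2 z)) = 1 \<and>
                       (\<forall>m<n. 1 < A (pair (pair (pr1 z) m) (pr2 z))))
      in if \<forall>n<pr2 z. \<not> stops n then 0 else Suc (LEAST n. pr2 z \<le> n \<or> stops n))"

lemma stage_simps:
  "stage ZeroF z = 1"
  "stage SuccF z = Suc (Suc (pr1 z))"
  "stage FstF z = Suc (pr1 (pr1 z))"
  "stage SndF z = Suc (pr2 (pr1 z))"
  by (simp_all add: stage_def)

lemma stage_PairF: "stage (PairF c d) = stage_PairF (stage c) (stage d)"
proof
  fix z show "stage (PairF c d) z = stage_PairF (stage c) (stage d) z"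
    unfolding stage_PairF_def stage_def
    by (cases "eval_upto c (pr2 z) (pr1 z)"; cases "eval_upto d (pr2 z) (pr1 z)") auto
qed

lemma stage_CompF: "stage (CompF c d) = stage_CompF (stage c) (stage d)"
proof
  fix z show "stage (CompF c d) z = stage_CompF (stage c) (stage d) z"
    unfolding stage_CompF_def stage_def by (cases "eval_upto d (pr2 z) (pr1 z)") auto
qed

lemma stage_PrecF: "stage (PrecF c d) = stage_PrecF (stage c) (stage d)"
proof
  fix z
  have "enc (rec_nat b (\<lambda>m r. Option.bind r (f m)) n) =
      rec_nat (enc b) (\<lambda>m r. if r = 0 then 0 else enc (f m (r - 1))) n" for b f n
  proof (induction n)
    case (Suc n)
    show ?case
      by (cases "rec_nat b (\<lambda>m r. Option.bind r (f m)) n") (simp_all flip: Suc.IH)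
  qed simp
  then show "stage (PrecF c d) z = stage_PrecF (stage c) (stage d) z"
    unfolding stage_PrecF_def stage_def prod_encode_inverse fst_conv snd_conv by simp
qed

lemma stage_MuF: "stage (MuF c) = stage_MuF (stage c)"
proof
  fix z
  define stops where "stops = search_stops (\<lambda>n. eval_upto c (pr2 z) (pair (pr1 z) n))"
  have "enc r = 1 \<longleftrightarrow> r = Some 0" "1 < enc r \<longleftrightarrow> (\<exists>v. r = Some (Suc v))" for r
    by (cases r; auto simp: gr0_conv_Suc)+
  then have *: "stage_MuF (stage c) z =
      (if \<forall>n<pr2 z. \<not> stops n then 0 else Suc (LEAST n. pr2 z \<le> n \<or> stops n))"
    by (simp add: stage_MuF_def stage_def stops_def search_stops_def Let_def)
  show "stage (MuF c) z = stage_MuF (stage c) z"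
  proof (cases "\<exists>n<pr2 z. stops n")
    case True
    then obtain n where n: "n < pr2 z" "stops n" by blast
    then have least: "(LEAST n. stops n) = n"
      unfolding stops_def by (intro Least_search_stops)
    have "(LEAST n. pr2 z \<le> n \<or> stops n) = n"
    proof (rule Least_equality)
      fix k assume "pr2 z \<le> k \<or> stops k"
      then show "n \<le> k" using n(1) least Least_le[of stops k] by auto
    qed (use n in blast)
    with n least True show ?thesis
      unfolding * unfolding stage_def eval_upto_MuF stops_def[symmetric] by auto
  next
    case False
    then show ?thesis
      unfolding * unfolding stage_def eval_upto_MuF stops_def[symmetric] by auto
  qed
qed

section \<open>Compiling programs for the bounded evaluation\<close>

lemma computable_operator:
  assumes "\<And>S A B. ucomp S A \<Longrightarrow> ucomp S B \<Longrightarrow> ucomp S (\<lambda>e. \<Phi> (A e) (B e))"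
  obtains g where "computable g"
    "\<And>i j A B. \<forall>x. phi i x = Some (A x) \<Longrightarrow> \<forall>x. phi j x = Some (B x) \<Longrightarrow>
      \<forall>x. phi (g (pair i j)) x = Some (\<Phi> A B x)"
proof -
  \<comment> \<open>The generic instance: the parameter \<open>u\<close> is a pair of indices of
    total functions, with the projections as index maps. Closure of \<open>ucomp\<close> under
    \<open>\<Phi>\<close> then yields one map on indices.\<close>
  define S where "S = {u. \<forall>x. phi (pr1 u) x \<noteq> None \<and> phi (pr2 u) x \<noteq> None}"
  have "ucomp S (\<lambda>u. \<Phi> (\<lambda>x. the (phi (pr1 u) x)) (\<lambda>x. the (phi (pr2 u) x)))"
    by (intro assms ucomp_phi computable_pr1 computable_pr2 computable_id) (auto simp: S_def)
  then obtain g where g: "computable g" "\<And>u x. u \<in> S \<Longrightarrow> phi (g u) x =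
      Some (\<Phi> (\<lambda>x. the (phi (pr1 u) x)) (\<lambda>x. the (phi (pr2 u) x)) x)"
    unfolding ucomp_def by blast
  show thesis
    by (rule that[OF g(1)]) (simp add: g(2) S_def)
qed

lemma computable_index:
  assumes "computable F"
  obtains i where "\<forall>x. phi i x = Some (F x)"
  using assms surj_code_of unfolding computable_def phi_def by (metis surjD)

lemma ucomp_stage: "ucomp UNIV (\<lambda>e. stage (code_of e))"
proof -
  obtain gP where gP: "computable gP"
    "\<And>i j A B. \<forall>x. phi i x = Some (A x) \<Longrightarrow> \<forall>x. phi j x = Some (B x) \<Longrightarrow>
      \<forall>x. phi (gP (pair i j)) x = Some (stage_PairF A B x)"
  proof (rule computable_operator[of stage_PairF])
    fix S A B assume A: "ucomp S A" and B: "ucomp S B"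
    note ops = A[THEN ucomp_comp] B[THEN ucomp_comp]
    show "ucomp S (\<lambda>e. stage_PairF (A e) (B e))"
      unfolding stage_PairF_def by (intro ucomp_intros ops)
  qed blast
  obtain gC where gC: "computable gC"
    "\<And>i j A B. \<forall>x. phi i x = Some (A x) \<Longrightarrow> \<forall>x. phi j x = Some (B x) \<Longrightarrow>
      \<forall>x. phi (gC (pair i j)) x = Some (stage_CompF A B x)"
  proof (rule computable_operator[of stage_CompF])
    fix S A B assume A: "ucomp S A" and B: "ucomp S B"
    note ops = A[THEN ucomp_comp] B[THEN ucomp_comp]
    show "ucomp S (\<lambda>e. stage_CompF (A e) (B e))"
      unfolding stage_CompF_def by (intro ucomp_intros ops)
  qed blast
  obtain gR where gR: "computable gR"
    "\<And>i j A B. \<forall>x. phi i x = Some (A x) \<Longrightarrow> \<forall>x. phi j x = Some (B x) \<Longrightarrow>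
      \<forall>x. phi (gR (pair i j)) x = Some (stage_PrecF A B x)"
  proof (rule computable_operator[of stage_PrecF])
    fix S A B assume A: "ucomp S A" and B: "ucomp S B"
    note ops = A[THEN ucomp_comp] B[THEN ucomp_comp]
    show "ucomp S (\<lambda>e. stage_PrecF (A e) (B e))"
      unfolding stage_PrecF_def by (intro ucomp_intros ops)
  qed blast
  obtain gM where gM: "computable gM"
    "\<And>i j A B. \<forall>x. phi i x = Some (A x) \<Longrightarrow> \<forall>x. phi j x = Some (B x) \<Longrightarrow>
      \<forall>x. phi (gM (pair i j)) x = Some (stage_MuF A x)"
  \<comment> \<open>Search has a single part; its index is passed twice below to fit the binary
    format.\<close>
  proof (rule computable_operator[of "\<lambda>A B. stage_MuF A"])
    fix S A assume A: "ucomp S A"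
    note ops = A[THEN ucomp_comp]
    show "ucomp S (\<lambda>e. stage_MuF (A e))"
      unfolding stage_MuF_def Let_def by (intro ucomp_intros ucomp_Least ops) auto
  qed blast
  obtain i0 where i0: "\<forall>x. phi i0 x = Some (stage ZeroF x)"
    by (rule computable_index[of "stage ZeroF"], unfold stage_simps[abs_def])
      (intro computable_ucomp ucomp_intros)
  obtain i1 where i1: "\<forall>x. phi i1 x = Some (stage SuccF x)"
    by (rule computable_index[of "stage SuccF"], unfold stage_simps[abs_def])
      (intro computable_ucomp ucomp_intros)
  obtain i2 where i2: "\<forall>x. phi i2 x = Some (stage FstF x)"
    by (rule computable_index[of "stage FstF"], unfold stage_simps[abs_def])
      (intro computable_ucomp ucomp_intros)
  obtain i3 where i3: "\<forall>x. phi i3 x = Some (stage SndF x)"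
    by (rule computable_index[of "stage SndF"], unfold stage_simps[abs_def])
      (intro computable_ucomp ucomp_intros)
  \<comment> \<open>\<open>G\<close> copies the case distinction of \<open>code_of\<close>; the
    indices already compiled for the parts are looked up in the history \<open>v\<close>.\<close>
  define G where "G n v =
     (if n = 0 then i0 else if n = 1 then i1 else if n = 2 then i2 else if n = 3 then i3 else
      let m = (n - 4) div 4; r = (n - 4) mod 4;
          ij = pair (lookup n v (pr1 m)) (lookup n v (pr2 m))
      in if r = 0 then gP ij else if r = 1 then gC ij else if r = 2 then gR ij
         else gM (pair (lookup n v m) (lookup n v m)))" for n v
  note ops = gP(1)[THEN ucomp_computable, THEN ucomp_comp]
    gC(1)[THEN ucomp_computable, THEN ucomp_comp]
    gR(1)[THEN ucomp_computable, THEN ucomp_comp]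
    gM(1)[THEN ucomp_computable, THEN ucomp_comp]
  have "computable (\<lambda>z. G (pr1 z) (pr2 z))"
    unfolding G_def Let_def
    by (intro computable_ucomp ucomp_intros ucomp_div4 ucomp_mod4 ucomp_lookup ops)
  then obtain h where h: "computable h" "\<And>n. h n = G n (history h n)"
    using course_of_values by blast
  have "\<forall>x. phi (h e) x = Some (stage (code_of e) x)" for e
  proof (induction e rule: less_induct)
    case (less e)
    show ?case
    proof (cases "e < 4")
      case True
      then have "e = 0 \<or> e = 1 \<or> e = 2 \<or> e = 3" by auto
      with i0 i1 i2 i3 show ?thesis by (auto simp: h(2)[of e] G_def code_of.simps[of e])
    next
      case False
      define m where "m = (e - 4) div 4"
      \<comment> \<open>These bounds justify both the lookups in the history and the induction
        hypotheses.\<close>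
      have m: "m < e" "pr1 m < e" "pr2 m < e"
        using index_part_less[of e] False fst_prod_decode_le[of m] snd_prod_decode_le[of m]
        unfolding m_def by linarith+
      have he: "h e =
         (if (e - 4) mod 4 = 0 then gP (pair (h (pr1 m)) (h (pr2 m)))
          else if (e - 4) mod 4 = 1 then gC (pair (h (pr1 m)) (h (pr2 m)))
          else if (e - 4) mod 4 = 2 then gR (pair (h (pr1 m)) (h (pr2 m)))
          else gM (pair (h m) (h m)))"
        using False m by (subst h(2)) (simp add: G_def Let_def lookup_history flip: m_def)
      have ce: "code_of e =
         (if (e - 4) mod 4 = 0 then PairF (code_of (pr1 m)) (code_of (pr2 m))
          else if (e - 4) mod 4 = 1 then CompF (code_of (pr1 m)) (code_of (pr2 m))
          else if (e - 4) mod 4 = 2 then PrecF (code_of (pr1 m)) (code_of (pr2 m))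
          else MuF (code_of m))"
        using False by (subst code_of.simps) (simp add: Let_def flip: m_def)
      note IH = less.IH[OF m(1)] less.IH[OF m(2)] less.IH[OF m(3)]
      show ?thesis
        unfolding he ce
        by (simp add: stage_PairF stage_CompF stage_PrecF stage_MuF
            gP(2)[OF IH(2,3)] gC(2)[OF IH(2,3)] gR(2)[OF IH(2,3)] gM(2)[OF IH(1,1)])
    qed
  qed
  with h(1) show ?thesis by (auto intro: ucompI)
qed

section \<open>The invariant of a co-enumerable equivalence relation\<close>

text \<open>This is \<open>Q\<^sub>t\<close>; the value 0 of \<open>stage\<close> signals that the
  bound \<open>t\<close> shows no convergence.\<close>

definition rel_upto :: "nat \<Rightarrow> nat \<Rightarrow> nat \<Rightarrow> nat \<Rightarrow> bool" where
  "rel_upto e t x y \<longleftrightarrow> stage (code_of e) (pair (pair x y) t) = 0"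

lemma rel_upto_antimono: "rel_upto e t x y \<Longrightarrow> s \<le> t \<Longrightarrow> rel_upto e s x y"
  unfolding rel_upto_def stage_def
  by (cases "eval_upto (code_of e) s (pair x y)") (auto dest: eval_upto_mono)

lemma rel_upto_limit: "(x, y) \<notin> W2 e \<longleftrightarrow> (\<forall>t. rel_upto e t x y)"
proof -
  have "eval c z = None \<longleftrightarrow> (\<forall>t. eval_upto c t z = None)" for c z
    by (metis eval_upto_complete eval_upto_sound not_None_eq)
  then show ?thesis by (auto simp: W2_def W_def phi_def rel_upto_def stage_def dom_def)
qed

text \<open>Confined to \<open>{0..m}\<close>, the equivalence axioms are decidable. The clause
  \<open>m \<le> t\<close> makes the stages eventually pass every given one.\<close>

definition good_stage :: "nat \<Rightarrow> nat \<Rightarrow> nat \<Rightarrow> bool" where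
  "good_stage e m t \<longleftrightarrow> m \<le> t \<and> (\<forall>i\<le>m. rel_upto e t i i \<and> (\<forall>j\<le>m.
     (rel_upto e t i j \<longrightarrow> rel_upto e t j i) \<and>
     (\<forall>k\<le>m. rel_upto e t i j \<longrightarrow> rel_upto e t j k \<longrightarrow> rel_upto e t i k)))"

text \<open>Only finitely many pairs lie in \<open>{0..m}\<close>. Once all those outside the
  equivalence relation have been enumerated, \<open>rel_upto\<close> agrees with it there and
  inherits its properties.\<close>

lemma good_stage_exists:
  assumes "equiv UNIV (UNIV - W2 e)"
  shows "\<exists>t. good_stage e m t"
proof -
  have "\<exists>s. (i, j) \<in> W2 e \<longrightarrow> \<not> rel_upto e s i j" for i j
    using rel_upto_limit by blast
  then obtain S where S: "\<And>i j. (i, j) \<in> W2 e \<Longrightarrow> \<not> rel_upto e (S i j) i j" by metis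
  define t where "t = Max (insert m (case_prod S ` ({..m} \<times> {..m})))"
  have "S i j \<le> t" if "i \<le> m" "j \<le> m" for i j
    unfolding t_def using that by (intro Max_ge) auto
  then have "(i, j) \<in> UNIV - W2 e \<longleftrightarrow> rel_upto e t i j" if "i \<le> m" "j \<le> m" for i j
    using that S rel_upto_limit rel_upto_antimono by blast
  moreover have "m \<le> t" unfolding t_def by (intro Max_ge) auto
  moreover have "refl (UNIV - W2 e)" "sym (UNIV - W2 e)" "trans (UNIV - W2 e)"
    using assms by (auto elim: equivE)
  ultimately have "good_stage e m t"
    unfolding good_stage_def by (meson UNIV_I reflD symD transD)
  then show ?thesis ..
qed

section \<open>Least good stages, parents and colours\<close>

definition stage_for :: "nat \<Rightarrow> nat \<Rightarrow> nat" where
  "stage_for e m = (LEAST t. good_stage e m t)"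

text \<open>With \<open>max x n\<close>, the stage is good for a segment containing
  \<open>x\<close>, and it is the same for all \<open>x \<le> n\<close>.\<close>

definition parent :: "nat \<Rightarrow> nat \<Rightarrow> nat \<Rightarrow> nat" where
  "parent e n x = (LEAST y. rel_upto e (stage_for e (max x n)) y x)"

text \<open>For \<open>e\<close> in \<open>equiv_indices\<close>, \<open>parent\<close> strictly
  decreases until it reaches a fixed point, so \<open>x\<close> iterations find it.\<close>

definition colour :: "nat \<Rightarrow> nat \<Rightarrow> nat \<Rightarrow> nat" where
  "colour e n x = rec_nat x (\<lambda>m v. parent e n v) x"

abbreviation equiv_indices :: "nat set" where
  "equiv_indices \<equiv> {e. equiv UNIV (UNIV - W2 e)}"

lemma good_stage_stage_for:
  "e \<in> equiv_indices \<Longrightarrow> good_stage e m (stage_for e m)"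
  unfolding stage_for_def using good_stage_exists by (auto intro: LeastI_ex)

text \<open>A stage good for a segment is good for every shorter one.\<close>

lemma stage_for_mono:
  assumes "e \<in> equiv_indices" "k \<le> m"
  shows "stage_for e k \<le> stage_for e m"
proof -
  have "good_stage e k (stage_for e m)"
    using good_stage_stage_for[OF assms(1), of m] assms(2) unfolding good_stage_def
    by (meson order_trans)
  then show ?thesis unfolding stage_for_def[of e k] by (rule Least_le)
qed

lemma parent_rel:
  assumes "e \<in> equiv_indices"
  shows "rel_upto e (stage_for e (max x n)) (parent e n x) x"
    and "rel_upto e (stage_for e (max x n)) y x \<Longrightarrow> parent e n x \<le> y"
proof -
  have "rel_upto e (stage_for e (max x n)) x x"
    using good_stage_stage_for[OF assms, of "max x n"] unfolding good_stage_def by simp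
  then show "rel_upto e (stage_for e (max x n)) (parent e n x) x"
    unfolding parent_def by (rule LeastI)
  show "parent e n x \<le> y" if "rel_upto e (stage_for e (max x n)) y x"
    unfolding parent_def using that by (rule Least_le)
qed

lemma parent_le: "e \<in> equiv_indices \<Longrightarrow> parent e n x \<le> x"
  using good_stage_stage_for[of e "max x n"] parent_rel(2) unfolding good_stage_def by simp

lemma funpow_parent_stable:
  assumes "e \<in> equiv_indices" "x \<le> k"
  shows "(parent e n ^^ k) x = (parent e n ^^ x) x"
proof -
  have fixp: "(parent e n ^^ k) x = x" if "parent e n x = x" for k x
    using that by (induction k) auto
  show ?thesis using assms(2)
  proof (induction x arbitrary: k rule: less_induct)
    case (less x)
    show ?case
    proof (cases "parent e n x = x")
      case True
      then show ?thesis by (simp add: fixp)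
    next
      case False
      then have lt: "parent e n x < x" using parent_le[OF assms(1), of n x] by simp
      then obtain x' k' where [simp]: "x = Suc x'" "k = Suc k'"
        using less.prems by (metis Suc_le_D not_less0 old.nat.exhaust)
      show ?thesis
        using less.IH[OF lt, of k'] less.IH[OF lt, of x'] lt less.prems
        by (simp add: funpow_swap1)
    qed
  qed
qed

lemma colour_funpow: "colour e n x = (parent e n ^^ x) x"
proof -
  have "rec_nat y (\<lambda>m v. parent e n v) k = (parent e n ^^ k) y" for y k
    by (induction k) auto
  then show ?thesis by (simp add: colour_def)
qed

text \<open>The two colours use different iteration counts; \<open>funpow_parent_stable\<close>
  evens this out.\<close>

lemma colour_parent:
  assumes "e \<in> equiv_indices"
  shows "colour e n x = colour e n (parent e n x)"
proof -
  have "(parent e n ^^ Suc x) x = (parent e n ^^ x) x"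
    by (rule funpow_parent_stable[OF assms]) simp
  moreover have "(parent e n ^^ Suc x) x = (parent e n ^^ x) (parent e n x)"
    by (simp add: funpow_swap1)
  moreover have "(parent e n ^^ x) (parent e n x) = (parent e n ^^ parent e n x) (parent e n x)"
    by (intro funpow_parent_stable parent_le assms)
  ultimately show ?thesis by (simp add: colour_funpow)
qed

text \<open>Induction on the larger number \<open>x\<close>. Its parent is at most \<open>y\<close>,
  so the induction hypothesis at \<open>y\<close> compares the parent with \<open>y\<close>, while
  \<open>x\<close> shares the colour of its parent.\<close>

lemma colour_eq_if_rel_upto:
  assumes "e \<in> equiv_indices" "y \<le> x" "rel_upto e (stage_for e (max x n)) y x"
  shows "colour e n y = colour e n x"
  using assms(2,3)
proof (induction x arbitrary: y rule: less_induct)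
  case (less x)
  let ?t = "stage_for e (max x n)" and ?z = "parent e n x"
  have z: "?z \<le> y" "rel_upto e ?t ?z x" using parent_rel[OF assms(1)] less.prems by auto
  show ?case
  proof (cases "y = x")
    case False
    \<comment> \<open>At stage \<open>?t\<close> the relation is symmetric and transitive on a
      segment containing all three numbers.\<close>
    have "rel_upto e ?t ?z y"
      using good_stage_stage_for[OF assms(1), of "max x n"] z less.prems
      unfolding good_stage_def by (meson max.cobounded1 order_trans)
    \<comment> \<open>The stage used for \<open>y\<close> is no later than \<open>?t\<close>, and
      passing to an earlier stage loses no related pair.\<close>
    then have "rel_upto e (stage_for e (max y n)) ?z y"
      by (rule rel_upto_antimono) (rule stage_for_mono[OF assms(1)], use less.prems(1) in auto)
    then have "colour e n ?z = colour e n y"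
      using less.IH[of y ?z] z less.prems False by simp
    then show ?thesis using colour_parent[OF assms(1)] by metis
  qed simp
qed

text \<open>Up to \<open>n\<close> all parents are taken at the single stage
  \<open>stage_for e n\<close>, where the relation is an equivalence on \<open>{0..n}\<close>. Each
  number is related to its colour there, so equal colours link \<open>x\<close> to \<open>y\<close>.
  As this stage is at least \<open>n\<close>, the link persists down to stage
  \<open>n\<close>.\<close>

lemma rel_upto_if_colour_eq:
  assumes "e \<in> equiv_indices" "x \<le> n" "y \<le> n" "colour e n x = colour e n y"
  shows "rel_upto e n x y"
proof -
  let ?R = "rel_upto e (stage_for e n)"
  have good: "good_stage e n (stage_for e n)" by (rule good_stage_stage_for[OF assms(1)])
  have root: "colour e n x \<le> x \<and> ?R (colour e n x) x" if "x \<le> n" for x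
    using that
  proof (induction x rule: less_induct)
    case (less x)
    have p: "?R (parent e n x) x"
      using parent_rel(1)[OF assms(1), of x n] less.prems by (simp add: max_def)
    show ?case
    proof (cases "parent e n x = x")
      case True
      then have "(parent e n ^^ k) x = x" for k by (induction k) auto
      with True p show ?thesis by (simp add: colour_funpow)
    next
      case False
      then have "parent e n x < x" using parent_le[OF assms(1), of n x] by simp
      with less show ?thesis
        using colour_parent[OF assms(1), of n x] p good unfolding good_stage_def
        by (metis less_imp_le order_trans)
    qed
  qed
  have "?R x y"
    using root[OF assms(2)] root[OF assms(3)] assms(2-4) good unfolding good_stage_def
    by (metis order_trans)
  moreover have "n \<le> stage_for e n" using good by (simp add: good_stage_def)
  ultimately show ?thesis by (rule rel_upto_antimono)
qed

lemma colour_invariant: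
  assumes "e \<in> equiv_indices"
  shows "(x, y) \<in> UNIV - W2 e \<longleftrightarrow> (\<forall>n. colour e n x = colour e n y)"
proof
  assume xy: "(x, y) \<in> UNIV - W2 e"
  \<comment> \<open>Both orders are derived because \<open>colour_eq_if_rel_upto\<close> has the
    smaller argument first.\<close>
  then have "(y, x) \<in> UNIV - W2 e" using assms by (auto elim!: equivE dest: symD)
  with xy have "rel_upto e t x y" "rel_upto e t y x" for t using rel_upto_limit by auto
  then show "\<forall>n. colour e n x = colour e n y"
    using colour_eq_if_rel_upto[OF assms] by (metis nat_le_linear)
next
  assume eq: "\<forall>n. colour e n x = colour e n y"
  have "rel_upto e t x y" for t
  proof -
    \<comment> \<open>A single \<open>n\<close> above \<open>x\<close>, \<open>y\<close> and
      \<open>t\<close> suffices.\<close>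
    have "rel_upto e (max t (max x y)) x y"
      using eq by (intro rel_upto_if_colour_eq assms) auto
    then show ?thesis by (rule rel_upto_antimono) simp
  qed
  then show "(x, y) \<in> UNIV - W2 e" using rel_upto_limit by blast
qed

section \<open>Uniform computability of the colours\<close>

lemma ucomp_colour: "ucomp equiv_indices (\<lambda>e z. colour e (pr2 z) (pr1 z))"
proof -
  have "ucomp equiv_indices (\<lambda>e. stage (code_of e))"
    using ucomp_stage unfolding ucomp_def by blast
  note stage = ucomp_comp[OF this]
  have rel: "udec equiv_indices (\<lambda>e x. rel_upto e (T e x) (I e x) (J e x))"
    if "ucomp equiv_indices T" "ucomp equiv_indices I" "ucomp equiv_indices J" for T I J
    unfolding rel_upto_def by (intro ucomp_intros stage that)
  \<comment> \<open>From here on, termination of the searches rests on the restriction to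
    \<open>equiv_indices\<close>.\<close>
  have "ucomp equiv_indices stage_for"
    unfolding stage_for_def[abs_def]
  proof (rule ucomp_Least)
    show "udec equiv_indices (\<lambda>e z. good_stage e (pr1 z) (pr2 z))"
      unfolding good_stage_def by (intro ucomp_intros rel)
  qed (use good_stage_exists in blast)
  note st = ucomp_comp[OF this]
  have "ucomp equiv_indices (\<lambda>e z. parent e (pr1 z) (pr2 z))"
    unfolding parent_def max_def
  proof (rule ucomp_Least)
    fix e z assume "e \<in> equiv_indices"
    from parent_rel(1)[OF this, of "pr2 z" "pr1 z"]
    show "\<exists>y. rel_upto e (stage_for e (if pr2 z \<le> pr1 z then pr1 z else pr2 z)) y (pr2 z)"
      by (auto simp: max_def)
  qed (intro ucomp_intros rel st)
  from ucomp_comp[OF this ucomp_pair]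
  have par: "ucomp equiv_indices (\<lambda>e x. parent e (A e x) (B e x))"
    if "ucomp equiv_indices A" "ucomp equiv_indices B" for A B using that by simp
  show ?thesis unfolding colour_def by (intro ucomp_intros par)
qed

theorem theorem5p1:
  shows "\<exists>a. \<forall>e E. equiv (UNIV :: nat set) E \<and> E = UNIV - W2 e \<longrightarrow>
    (\<exists>i f. phi a e = Some i \<and> total_index i f \<and>
       (\<forall>x y. (x, y) \<in> E \<longleftrightarrow> (\<forall>n. f (x, n) = f (y, n))))"
proof -
  obtain g where g: "computable g"
    "\<And>e z. e \<in> equiv_indices \<Longrightarrow> phi (g e) z = Some (colour e (pr2 z) (pr1 z))"
    using ucomp_colour unfolding ucomp_def by blast
  \<comment> \<open>\<open>a\<close> is an index of \<open>g\<close>, the algorithm turning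
    \<open>e\<close> into an index of its colour function.\<close>
  obtain a where a: "\<forall>e. phi a e = Some (g e)" using computable_index[OF g(1)] .
  show ?thesis
  proof (rule exI[of _ a], intro allI impI)
    fix e E assume E: "equiv (UNIV :: nat set) E \<and> E = UNIV - W2 e"
    then have e: "e \<in> equiv_indices" by auto
    show "\<exists>i f. phi a e = Some i \<and> total_index i f \<and>
       (\<forall>x y. (x, y) \<in> E \<longleftrightarrow> (\<forall>n. f (x, n) = f (y, n)))"
    proof (intro exI[of _ "g e"] exI[of _ "\<lambda>(x, n). colour e n x"] conjI)
      show "phi a e = Some (g e)" using a ..
      show "total_index (g e) (\<lambda>(x, n). colour e n x)"
        by (simp add: total_index_def g(2)[OF e])
      show "\<forall>x y. (x, y) \<in> E \<longleftrightarrow>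
          (\<forall>n. (\<lambda>(x, n). colour e n x) (x, n) = (\<lambda>(x, n). colour e n x) (y, n))"
        using colour_invariant[OF e] E by simp
    qed
  qed
qed

end
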